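(* Let $p>0$, let $J\subset\mathbb{R}^+$ be an interval with $(0,1)\subset J$, and let $h:J\to\mathbb{R}^+$ be a non-zero super-multiplicative function satisfying $2h(1/2)\le\alpha^{-1}h(\alpha)$ for all $\alpha\in(0,1)$. Let $H$ be a finite dimensional Hilbert space, $\Phi$ a unital positive linear map on $B(H)$, $A$ a positive operator on $H$, and $f$ an operator $(p,h)$-convex function on $\mathbb{R}^+$ such that $f(0)=0$. Then $$f\big((\Phi(A^p))^{1/p}\big)\le 2h(1/2)\,\Phi(f(A)).$$
   Context: $\mathbb{R}^+=[0,\infty)$. $B(H)$ is the algebra of bounded linear operators on the complex Hilbert space $H$; "positive operator" means positive semidefinite; $\Phi:B(H)\to B(H)$ linear is positive if it maps positive operators to positive operators, and unital if $\Phi(I_H)=I_H$. $\mathbb{M}_n^+$ is the set of positive semidefinite $n\times n$ complex matrices; $X\le Y$ means $Y-X$ is positive semidefinite; functions of self-adjoint operators are defined by functional calculus. A function $h:J\to\mathbb{R}^+$ is super-multiplicative if $h(xy)\ge h(x)h(y)$ for all $x,y\in J$ (with $xy\in J$); non-zero means not identically zero. A non-negative continuous function $f:\mathbb{R}^+\to\mathbb{R}$ is operator $(p,h)$-convex on $\mathbb{R}^+$ if $$f\big([\alpha A^p+(1-\alpha)B^p]^{1/p}\big)\le h(\alpha)f(A)+h(1-\alpha)f(B)$$ for every $n\ge1$, all $A,B\in\mathbb{M}_n^+$, and all $\alpha\in(0,1)$. *)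

theory Defs
  imports
    "HOL-Analysis.Topology_Euclidean_Space"
    "Jordan_Normal_Form.Schur_Decomposition"
begin

text \<open>
  Inner products are linear in the first argument, as is \<open>\<bullet>c\<close> on complex vectors.  The order on
  complex numbers is that of \<open>Complex_Order\<close>, so \<open>0 \<le> z\<close> says that \<open>z\<close> is real and nonnegative.
  Completeness is automatic in finite dimension, so no topology is required.
  The zero space is allowed.
\<close>

class fin_dim_hilbert = ab_group_add +
  fixes scaleC :: "complex \<Rightarrow> 'a \<Rightarrow> 'a"  (infixr \<open>*\<^sub>C\<close> 75)
    and cinner :: "'a \<Rightarrow> 'a \<Rightarrow> complex"
  assumes scaleC_add_right: "a *\<^sub>C (x + y) = a *\<^sub>C x + a *\<^sub>C y"
    and scaleC_add_left: "(a + b) *\<^sub>C x = a *\<^sub>C x + b *\<^sub>C x"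
    and scaleC_scaleC: "a *\<^sub>C b *\<^sub>C x = (a * b) *\<^sub>C x"
    and scaleC_one: "1 *\<^sub>C x = x"
    and cinner_commute: "cinner x y = cnj (cinner y x)"
    and cinner_add_left: "cinner (x + y) z = cinner x z + cinner y z"
    and cinner_scaleC_left: "cinner (a *\<^sub>C x) y = a * cinner x y"
    and cinner_ge_zero: "0 \<le> cinner x x"
    and cinner_eq_zero_iff: "cinner x x = 0 \<longleftrightarrow> x = 0"
    and finite_spanning_set: "\<exists>B. finite B \<and> (\<forall>x. \<exists>c. x = (\<Sum>b\<in>B. c b *\<^sub>C b))"

interpretation cvec: vector_space "scaleC :: complex \<Rightarrow> 'a \<Rightarrow> 'a::fin_dim_hilbert"
  by unfold_locales (simp_all add: scaleC_add_right scaleC_add_left scaleC_scaleC scaleC_one)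

text \<open>The algebra \<open>B(H)\<close>: in finite dimension every linear operator is bounded.\<close>

definition BH :: "('a::fin_dim_hilbert \<Rightarrow> 'a) set" where
  "BH = {T. Vector_Spaces.linear scaleC scaleC T}"

text \<open>On a complex space the condition on the quadratic form entails self-adjointness.\<close>

definition positive_op :: "('a::fin_dim_hilbert \<Rightarrow> 'a) \<Rightarrow> bool" where
  "positive_op T \<longleftrightarrow> T \<in> BH \<and> (\<forall>v. 0 \<le> cinner (T v) v)"

definition le_op :: "('a::fin_dim_hilbert \<Rightarrow> 'a) \<Rightarrow> ('a \<Rightarrow> 'a) \<Rightarrow> bool" where
  "le_op S T \<longleftrightarrow> positive_op (\<lambda>v. T v - S v)"

definition eigenspace :: "('a::fin_dim_hilbert \<Rightarrow> 'a) \<Rightarrow> complex \<Rightarrow> 'a set" where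
  "eigenspace T l = {v. T v = l *\<^sub>C v}"

definition spectrum_op :: "('a::fin_dim_hilbert \<Rightarrow> 'a) \<Rightarrow> complex set" where
  "spectrum_op T = {l. \<exists>v. v \<noteq> 0 \<and> T v = l *\<^sub>C v}"

text \<open>Meaningful when \<open>M\<close> is a subspace.\<close>

definition orth_proj :: "'a::fin_dim_hilbert set \<Rightarrow> 'a \<Rightarrow> 'a" where
  "orth_proj M v = (THE w. w \<in> M \<and> (\<forall>u\<in>M. cinner (v - w) u = 0))"

text \<open>
  Functional calculus of a self-adjoint operator through its spectral decomposition
  \<open>T = (\<Sum>l. l E\<^sub>l)\<close>, namely \<open>f(T) = (\<Sum>l. f(l) E\<^sub>l)\<close>.  The spectrum is then real, so \<open>Re\<close> only
  adapts types.
\<close>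

definition fun_op :: "(real \<Rightarrow> real) \<Rightarrow> ('a::fin_dim_hilbert \<Rightarrow> 'a) \<Rightarrow> 'a \<Rightarrow> 'a" where
  "fun_op f T v = (\<Sum>l\<in>spectrum_op T. of_real (f (Re l)) *\<^sub>C orth_proj (eigenspace T l) v)"

definition unital_positive_linear_map ::
    "(('a::fin_dim_hilbert \<Rightarrow> 'a) \<Rightarrow> ('a \<Rightarrow> 'a)) \<Rightarrow> bool" where
  "unital_positive_linear_map \<Phi> \<longleftrightarrow>
     (\<forall>T\<in>BH. \<Phi> T \<in> BH) \<and>
     (\<forall>S\<in>BH. \<forall>T\<in>BH. \<Phi> (\<lambda>v. S v + T v) = (\<lambda>v. \<Phi> S v + \<Phi> T v)) \<and>
     (\<forall>c. \<forall>T\<in>BH. \<Phi> (\<lambda>v. c *\<^sub>C T v) = (\<lambda>v. c *\<^sub>C \<Phi> T v)) \<and>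
     (\<forall>T. positive_op T \<longrightarrow> positive_op (\<Phi> T)) \<and>
     \<Phi> (\<lambda>v. v) = (\<lambda>v. v)"

definition psd_mat :: "nat \<Rightarrow> complex mat set" where
  "psd_mat n = {A \<in> carrier_mat n n. \<forall>v\<in>carrier_vec n. 0 \<le> (A *\<^sub>v v) \<bullet>c v}"

definition le_mat :: "nat \<Rightarrow> complex mat \<Rightarrow> complex mat \<Rightarrow> bool" where
  "le_mat n X Y \<longleftrightarrow> X \<in> carrier_mat n n \<and> Y \<in> carrier_mat n n \<and> Y - X \<in> psd_mat n"

definition unitary_mat :: "nat \<Rightarrow> complex mat \<Rightarrow> bool" where
  "unitary_mat n U \<longleftrightarrow> U \<in> carrier_mat n n \<and>
     mat_adjoint U * U = 1\<^sub>m n \<and> U * mat_adjoint U = 1\<^sub>m n"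

text \<open>
  Functional calculus of a Hermitian matrix: if \<open>A = U diag(d) U\<^sup>*\<close> with \<open>U\<close> unitary then
  \<open>f(A) = U diag(f(d)) U\<^sup>*\<close>.  The result does not depend on the diagonalization, hence the
  definite description.
\<close>

definition fun_mat :: "(real \<Rightarrow> real) \<Rightarrow> complex mat \<Rightarrow> complex mat" where
  "fun_mat f A = (THE B. \<exists>U (d :: nat \<Rightarrow> real). let n = dim_row A in
     unitary_mat n U \<and>
     A = U * mat_diag n (\<lambda>i. of_real (d i)) * mat_adjoint U \<and>
     B = U * mat_diag n (\<lambda>i. of_real (f (d i))) * mat_adjoint U)"

text \<open>
  Functions on \<open>[0, \<infinity>)\<close> are total functions whose values at negative numbers are irrelevant.
  For \<open>p > 0\<close> the convention \<open>0 powr p = 0\<close> is the intended value.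
\<close>

definition operator_ph_convex :: "real \<Rightarrow> (real \<Rightarrow> real) \<Rightarrow> (real \<Rightarrow> real) \<Rightarrow> bool" where
  "operator_ph_convex p h f \<longleftrightarrow>
     continuous_on {0..} f \<and> (\<forall>x\<ge>0. 0 \<le> f x) \<and>
     (\<forall>n\<ge>1. \<forall>A\<in>psd_mat n. \<forall>B\<in>psd_mat n. \<forall>\<alpha>\<in>{0<..<1}.
        le_mat n
          (fun_mat f (fun_mat (\<lambda>x. x powr (1 / p))
             (of_real \<alpha> \<cdot>\<^sub>m fun_mat (\<lambda>x. x powr p) A +
              of_real (1 - \<alpha>) \<cdot>\<^sub>m fun_mat (\<lambda>x. x powr p) B)))
          (of_real (h \<alpha>) \<cdot>\<^sub>m fun_mat f A + of_real (h (1 - \<alpha>)) \<cdot>\<^sub>m fun_mat f B))"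

definition super_multiplicative_on :: "real set \<Rightarrow> (real \<Rightarrow> real) \<Rightarrow> bool" where
  "super_multiplicative_on J h \<longleftrightarrow>
     (\<forall>x\<in>J. \<forall>y\<in>J. x * y \<in> J \<longrightarrow> h x * h y \<le> h (x * y))"

end

theory Submission
  imports Defs "Jordan_Normal_Form.Spectral_Radius"
begin

text \<open>
  Diagonalize \<open>A = (\<Sum>i. d\<^sub>i R\<^sub>i)\<close> with rank-one projections \<open>R\<^sub>i\<close>.  Then \<open>\<Phi>(g(A)) = (\<Sum>i. g(d\<^sub>i) \<Phi>(R\<^sub>i))\<close>,
  where the \<open>\<Phi>(R\<^sub>i)\<close> are positive and sum to the identity.  Splitting each \<open>\<Phi>(R\<^sub>i)\<close> into rank-one
  pieces yields a Naimark dilation: an isometry \<open>V\<close> and a diagonal matrix \<open>X\<close> with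
  \<open>\<Phi>(g(A)) = V\<^sup>* g(X) V\<close> for every \<open>g\<close>.  It remains to show
  \<open>f((V\<^sup>* X\<^sup>p V)\<^sup>1\<^sup>/\<^sup>p) \<le> 2 h(1/2) V\<^sup>* f(X) V\<close>.  The reflection \<open>W = 2 V V\<^sup>* - 1\<close> is unitary and
  \<open>(X\<^sup>p + W X\<^sup>p W) / 2\<close> commutes with \<open>V V\<^sup>*\<close> and compresses to \<open>V\<^sup>* X\<^sup>p V\<close>; hence compressing the
  convexity inequality for \<open>X\<close> and \<open>W X W\<close> with weight \<open>1/2\<close> gives the claim.
\<close>

unbundle no vec_syntax \<comment> \<open>\<open>$\<close> is only indexing of \<open>Matrix.vec\<close>\<close>

section \<open>Spectral theorem for Hermitian matrices\<close>

lemma mat_adjoint_dim [simp]: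
  "dim_row (mat_adjoint A) = dim_col A" "dim_col (mat_adjoint A) = dim_row A"
  by (simp_all add: mat_adjoint_def)

lemma mat_adjoint_carrier [simp]: "A \<in> carrier_mat n m \<Longrightarrow> mat_adjoint A \<in> carrier_mat m n"
  by (intro carrier_matI) simp_all

lemma mat_adjoint_index [simp]:
  fixes A :: "complex mat"
  shows "i < dim_col A \<Longrightarrow> j < dim_row A \<Longrightarrow> mat_adjoint A $$ (i, j) = cnj (A $$ (j, i))"
  unfolding mat_adjoint_def by (subst mat_of_rows_index) simp_all

lemma mat_adjoint_mat_adjoint [simp]: "mat_adjoint (mat_adjoint A) = (A :: complex mat)"
  by (rule eq_matI) auto

lemma mat_adjoint_mult:
  fixes A B :: "complex mat"
  assumes "A \<in> carrier_mat n m" "B \<in> carrier_mat m k"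
  shows "mat_adjoint (A * B) = mat_adjoint B * mat_adjoint A"
  using assms by (intro eq_matI) (simp_all add: scalar_prod_def mult.commute)

lemma mat_adjoint_add:
  fixes A B :: "complex mat"
  assumes "A \<in> carrier_mat n m" "B \<in> carrier_mat n m"
  shows "mat_adjoint (A + B) = mat_adjoint A + mat_adjoint B"
  using assms by (intro eq_matI) auto

lemma mat_adjoint_minus:
  fixes A B :: "complex mat"
  assumes "A \<in> carrier_mat n m" "B \<in> carrier_mat n m"
  shows "mat_adjoint (A - B) = mat_adjoint A - mat_adjoint B"
  using assms by (intro eq_matI) auto

lemma mat_adjoint_smult: "mat_adjoint (c \<cdot>\<^sub>m A) = cnj c \<cdot>\<^sub>m mat_adjoint (A :: complex mat)"
  by (rule eq_matI) auto

lemma mat_adjoint_one [simp]: "mat_adjoint (1\<^sub>m n) = (1\<^sub>m n :: complex mat)"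
  by (rule eq_matI) auto

lemma mat_adjoint_diag_real [simp]:
  "mat_adjoint (mat_diag n (\<lambda>i. complex_of_real (d i))) = mat_diag n (\<lambda>i. complex_of_real (d i))"
  by (rule eq_matI) (auto simp: mat_diag_def)

lemma mat_adjoint_four_block:
  fixes A B C D :: "complex mat"
  assumes "A \<in> carrier_mat a c" "B \<in> carrier_mat a d" "C \<in> carrier_mat b c" "D \<in> carrier_mat b d"
  shows "mat_adjoint (four_block_mat A B C D) =
    four_block_mat (mat_adjoint A) (mat_adjoint C) (mat_adjoint B) (mat_adjoint D)"
  using assms by (intro eq_matI) (auto simp: index_mat_four_block(1))

lemma cscalar_mat_adjoint:
  fixes A :: "complex mat"
  assumes "A \<in> carrier_mat n m" "x \<in> carrier_vec m" "y \<in> carrier_vec n"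
  shows "(A *\<^sub>v x) \<bullet>c y = x \<bullet>c (mat_adjoint A *\<^sub>v y)"
proof -
  have "(A *\<^sub>v x) \<bullet>c y = (\<Sum>i<n. \<Sum>j<m. A $$ (i, j) * x $ j * cnj (y $ i))"
    using assms by (auto simp: scalar_prod_def sum_distrib_right atLeast0LessThan intro!: sum.cong)
  also have "\<dots> = (\<Sum>j<m. \<Sum>i<n. A $$ (i, j) * x $ j * cnj (y $ i))"
    by (rule sum.swap)
  also have "\<dots> = x \<bullet>c (mat_adjoint A *\<^sub>v y)"
    using assms
    by (auto simp: scalar_prod_def sum_distrib_left atLeast0LessThan intro!: sum.cong)
  finally show ?thesis .
qed

lemma unitary_matI:
  assumes "U \<in> carrier_mat n n" "mat_adjoint U * U = 1\<^sub>m n"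
  shows "unitary_mat n U"
  using assms mat_mult_left_right_inverse[of "mat_adjoint U" n U] by (simp add: unitary_mat_def)

lemma unitary_mat_mult:
  assumes "unitary_mat n U" "unitary_mat n W"
  shows "unitary_mat n (U * W)"
proof (rule unitary_matI)
  have U: "U \<in> carrier_mat n n" "mat_adjoint U * U = 1\<^sub>m n"
    and W: "W \<in> carrier_mat n n" "mat_adjoint W * W = 1\<^sub>m n"
    using assms by (auto simp: unitary_mat_def)
  show "U * W \<in> carrier_mat n n" using U W by simp
  have "mat_adjoint (U * W) * (U * W) = mat_adjoint W * (mat_adjoint U * U) * W"
    using U(1) W(1) by (simp add: mat_adjoint_mult[of _ n n _ n] assoc_mult_mat[of _ n n _ n _ n] mult_carrier_mat[of _ n n _ n])
  then show "mat_adjoint (U * W) * (U * W) = 1\<^sub>m n"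
    using U W by simp
qed

text \<open>Gram-Schmidt applied to a basis that starts with \<open>v\<close> leaves its first
  vector unchanged; normalizing the orthogonal vectors gives the columns, and \<open>c\<close> is
  the normalizing factor of \<open>v\<close>.\<close>

lemma exists_unitary_first_column:
  fixes v :: "complex vec"
  assumes v: "v \<in> carrier_vec n" "v \<noteq> 0\<^sub>v n"
  obtains U c where "unitary_mat n U" "col U 0 = c \<cdot>\<^sub>v v"
proof -
  interpret cof_vec_space n "TYPE(complex)" .
  define b where "b = basis_completion v"
  define ws where "ws = gram_schmidt n b"
  note bc = basis_completion[OF v, folded b_def]
  have n: "n \<noteq> 0" using v by auto
  obtain vs where bv: "b = v # vs" using bc n by (cases b) auto
  note gs = gram_schmidt_result[OF bc(2,4,5) refl, folded ws_def]
  have hd: "hd ws = v"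
    unfolding ws_def bv using v(1) by (rule gram_schmidt_hd)
  have len: "length ws = n" using gs bc by simp
  have ws_c: "ws ! i \<in> carrier_vec n" if "i < n" for i
    using gs len that nth_mem by blast
  \<comment> \<open>\<open>gram_schmidt\<close> only orthogonalizes, so each column is still to be
    divided by its norm.\<close>
  define r where "r i = complex_of_real (1 / sqrt (Re (ws ! i \<bullet>c ws ! i)))" for i
  define U where "U = mat n n (\<lambda>(i, j). r j * ws ! j $ i)"
  have "(mat_adjoint U * U) $$ (i, j) = 1\<^sub>m n $$ (i, j)" if ij: "i < n" "j < n" for i j
  proof -
    have "(mat_adjoint U * U) $$ (i, j) = (\<Sum>k<n. r i * r j * (ws ! j $ k * cnj (ws ! i $ k)))"
      using ij by (auto simp: U_def scalar_prod_def atLeast0LessThan r_def intro!: sum.cong)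
    also have "\<dots> = r i * r j * (ws ! j \<bullet>c ws ! i)"
      using ws_c[OF ij(1)] ws_c[OF ij(2)]
      by (simp add: scalar_prod_def sum_distrib_left atLeast0LessThan)
    also have "\<dots> = (if i = j then 1 else 0)"
    proof (cases "i = j")
      case True
      have "ws ! j \<bullet>c ws ! j \<noteq> 0" "0 \<le> ws ! j \<bullet>c ws ! j"
        using corthogonalD[of ws j j] gs len ij by auto
      then obtain x where x: "ws ! j \<bullet>c ws ! j = complex_of_real x" "x > 0"
        by (intro that[of "Re (ws ! j \<bullet>c ws ! j)"]) (auto simp: complex_eq_iff less_eq_complex_def)
      have "r j * r j * complex_of_real x = 1"
        using x by (simp add: r_def flip: of_real_mult)
      then show ?thesis using True x by simp
    next
      case False
      then show ?thesis using corthogonalD[of ws j i] gs len ij by auto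
    qed
    finally show ?thesis using ij by simp
  qed
  then have "mat_adjoint U * U = 1\<^sub>m n"
    by (intro eq_matI) (auto simp: U_def)
  then have "unitary_mat n U"
    by (intro unitary_matI) (auto simp: U_def)
  moreover have "col U 0 = r 0 \<cdot>\<^sub>v v"
  proof (rule eq_vecI)
    have "ws ! 0 = v" using hd n len by (metis hd_conv_nth length_0_conv)
    then show "col U 0 $ i = (r 0 \<cdot>\<^sub>v v) $ i" if "i < dim_vec (r 0 \<cdot>\<^sub>v v)" for i
      using n v that by (auto simp: U_def)
  qed (use v in \<open>auto simp: U_def\<close>)
  ultimately show ?thesis ..
qed

text \<open>Deflation: when the first column of \<open>U\<close> is an eigenvector, the first column
  of \<open>mat_adjoint U * A * U\<close> is a multiple of the first unit vector. As this matrix is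
  Hermitian, its first row vanishes off the corner too, and the remaining Hermitian block falls to
  the induction hypothesis.\<close>

theorem hermitian_unitary_diagonalization:
  fixes A :: "complex mat"
  assumes "A \<in> carrier_mat n n" "mat_adjoint A = A"
  shows "\<exists>U (d :: nat \<Rightarrow> real). unitary_mat n U \<and>
    A = U * mat_diag n (\<lambda>i. of_real (d i)) * mat_adjoint U"
  using assms
proof (induction n arbitrary: A)
  case 0
  then show ?case by (intro exI[of _ "1\<^sub>m 0"] exI[of _ "\<lambda>_. 0"] conjI eq_matI) (auto simp: unitary_mat_def)
next
  case (Suc m)
  let ?n = "Suc m"
  note A = Suc.prems
  obtain e where "e \<in> spectrum A" using spectrum_non_empty[OF A(1)] by auto
  then obtain v where v: "v \<in> carrier_vec ?n" "v \<noteq> 0\<^sub>v ?n" "A *\<^sub>v v = e \<cdot>\<^sub>v v"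
    using A by (auto simp: spectrum_def eigenvalue_def eigenvector_def)
  obtain U c where U: "unitary_mat ?n U" "col U 0 = c \<cdot>\<^sub>v v"
    using exists_unitary_first_column[OF v(1,2)] .
  have Uc: "U \<in> carrier_mat ?n ?n" and UU: "mat_adjoint U * U = 1\<^sub>m ?n" "U * mat_adjoint U = 1\<^sub>m ?n"
    using U by (auto simp: unitary_mat_def)
  define B where "B = mat_adjoint U * A * U"
  have B: "B \<in> carrier_mat ?n ?n" using Uc A by (simp add: B_def mult_carrier_mat[of _ ?n ?n _ ?n])
  have Bh: "mat_adjoint B = B"
    using Uc A by (simp add: B_def mat_adjoint_mult[of _ ?n ?n _ ?n] assoc_mult_mat[of _ ?n ?n _ ?n _ ?n] mult_carrier_mat[of _ ?n ?n _ ?n])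
  have Bsym: "cnj (B $$ (j, i)) = B $$ (i, j)" if "i < ?n" "j < ?n" for i j
    using mat_adjoint_index[of i B j] Bh B that by simp
  have col0: "B $$ (i, 0) = (if i = 0 then e else 0)" if i: "i < ?n" for i
  proof -
    have "col B 0 = mat_adjoint U *\<^sub>v (A *\<^sub>v col U 0)"
      using Uc A by (simp add: B_def assoc_mult_mat[of _ ?n ?n _ ?n _ ?n] mult_carrier_mat[of _ ?n ?n _ ?n]
          col_mult2[of _ ?n ?n _ ?n] del: col_mult)
    also have "A *\<^sub>v col U 0 = e \<cdot>\<^sub>v col U 0"
      using A v by (simp add: U(2) mult_mat_vec[of _ ?n ?n] smult_smult_assoc mult.commute)
    also have "mat_adjoint U *\<^sub>v (e \<cdot>\<^sub>v col U 0) = e \<cdot>\<^sub>v (mat_adjoint U *\<^sub>v col U 0)"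
      using Uc by (auto simp: mult_mat_vec[of _ ?n ?n])
    also have "mat_adjoint U *\<^sub>v col U 0 = col (1\<^sub>m ?n) 0"
      using Uc by (simp add: UU(1)[symmetric] col_mult2[of _ ?n ?n _ ?n])
    finally have "col B 0 $ i = (e \<cdot>\<^sub>v col (1\<^sub>m ?n) 0) $ i" by simp
    then show ?thesis using i B by (auto split: if_splits)
  qed
  \<comment> \<open>The eigenvalue is a diagonal entry of the Hermitian matrix \<open>B\<close>,
    hence real.\<close>
  have e: "complex_of_real (Re e) = e"
    using col0[of 0] Bsym[of 0 0] by (metis Reals_cnj_iff complex_is_Real_iff of_real_Re zero_less_Suc)
  define C where "C = mat m m (\<lambda>(i, j). B $$ (Suc i, Suc j))"
  have C: "C \<in> carrier_mat m m" "mat_adjoint C = C"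
    using B by (auto simp: C_def Bsym intro!: eq_matI)
  obtain U' and d' :: "nat \<Rightarrow> real" where U': "unitary_mat m U'"
    and Cd: "C = U' * mat_diag m (\<lambda>i. of_real (d' i)) * mat_adjoint U'"
    using Suc.IH[OF C] by blast
  have U'c: "U' \<in> carrier_mat m m" "mat_adjoint U' * U' = 1\<^sub>m m" using U' by (auto simp: unitary_mat_def)
  define d where "d i = (case i of 0 \<Rightarrow> Re e | Suc i \<Rightarrow> d' i)" for i
  \<comment> \<open>The diagonalizing unitary of the block \<open>C\<close>, extended by a 1 in the
    corner; \<open>U * V\<close> will diagonalize \<open>A\<close>.\<close>
  define V where "V = four_block_mat (1\<^sub>m 1) (0\<^sub>m 1 m) (0\<^sub>m m 1) U'"
  let ?E = "mat 1 1 (\<lambda>_. e)"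
  have V: "V \<in> carrier_mat ?n ?n" using U'c four_block_carrier_mat[of "1\<^sub>m 1" 1 1 U' m m] by (simp add: V_def)
  have Vadj: "mat_adjoint V = four_block_mat (1\<^sub>m 1) (0\<^sub>m 1 m) (0\<^sub>m m 1) (mat_adjoint U')"
    unfolding V_def using U'c
    by (subst mat_adjoint_four_block[of _ 1 1 _ m _ m]) (auto intro!: arg_cong2[where f="\<lambda>x y. four_block_mat (1\<^sub>m 1) x y _"] eq_matI)
  have "mat_adjoint V * V = four_block_mat (1\<^sub>m 1) (0\<^sub>m 1 m) (0\<^sub>m m 1) (1\<^sub>m m)"
    unfolding Vadj unfolding V_def using U'c
    by (subst mult_four_block_mat[of _ 1 1 _ m _ m _ _ 1 _ m]) auto
  also have "\<dots> = 1\<^sub>m ?n" by (rule eq_matI) auto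
  finally have Vu: "unitary_mat ?n V" using V by (intro unitary_matI)
  have D: "mat_diag ?n (\<lambda>i. complex_of_real (d i)) =
      four_block_mat ?E (0\<^sub>m 1 m) (0\<^sub>m m 1) (mat_diag m (\<lambda>i. of_real (d' i)))"
    by (rule eq_matI) (auto simp: mat_diag_def d_def e split: nat.splits)
  have "B = four_block_mat ?E (0\<^sub>m 1 m) (0\<^sub>m m 1) C"
  proof (rule eq_matI)
    fix i j assume "i < dim_row (four_block_mat ?E (0\<^sub>m 1 m) (0\<^sub>m m 1) C)"
      "j < dim_col (four_block_mat ?E (0\<^sub>m 1 m) (0\<^sub>m m 1) C)"
    then have "i < ?n" "j < ?n" by (auto simp: C_def)
    then show "B $$ (i, j) = four_block_mat ?E (0\<^sub>m 1 m) (0\<^sub>m m 1) C $$ (i, j)"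
      using col0[of i] col0[of j] Bsym[of i j] e
      by (cases i; cases j) (auto simp: C_def)
  qed (use B in \<open>auto simp: C_def\<close>)
  also have "\<dots> = V * mat_diag ?n (\<lambda>i. of_real (d i)) * mat_adjoint V"
  proof -
    have "V * mat_diag ?n (\<lambda>i. of_real (d i)) =
        four_block_mat ?E (0\<^sub>m 1 m) (0\<^sub>m m 1) (U' * mat_diag m (\<lambda>i. of_real (d' i)))"
      unfolding D unfolding V_def using U'c
      by (subst mult_four_block_mat[of _ 1 1 _ m _ m _ _ 1 _ m])
        (auto simp: mult_carrier_mat[of _ m m _ m] left_mult_zero_mat[of _ m m])
    also have "\<dots> * mat_adjoint V = four_block_mat ?E (0\<^sub>m 1 m) (0\<^sub>m m 1) C"
      unfolding Vadj Cd using U'c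
      by (subst mult_four_block_mat[of _ 1 1 _ m _ m _ _ 1 _ m])
        (auto simp: mult_carrier_mat[of _ m m _ m] right_mult_zero_mat[of _ m m])
    finally show ?thesis by simp
  qed
  finally have BV: "B = V * mat_diag ?n (\<lambda>i. of_real (d i)) * mat_adjoint V" .
  have "A = (U * mat_adjoint U) * A * (U * mat_adjoint U)" using A UU by simp
  also have "\<dots> = U * B * mat_adjoint U"
    using A Uc by (simp add: B_def assoc_mult_mat[of _ ?n ?n _ ?n _ ?n] mult_carrier_mat[of _ ?n ?n _ ?n])
  also have "\<dots> = (U * V) * mat_diag ?n (\<lambda>i. of_real (d i)) * mat_adjoint (U * V)"
    using Uc V by (simp add: BV mat_adjoint_mult[of _ ?n ?n _ ?n] assoc_mult_mat[of _ ?n ?n _ ?n _ ?n] mult_carrier_mat[of _ ?n ?n _ ?n])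
  finally show ?case using unitary_mat_mult[OF U(1) Vu] by blast
qed

section \<open>Compression of convex functions\<close>

lemma psd_mat_congruence:
  assumes "A \<in> psd_mat n" "V \<in> carrier_mat n m"
  shows "mat_adjoint V * A * V \<in> psd_mat m"
proof -
  have A: "A \<in> carrier_mat n n" "\<And>v. v \<in> carrier_vec n \<Longrightarrow> 0 \<le> (A *\<^sub>v v) \<bullet>c v"
    using assms by (auto simp: psd_mat_def)
  have c: "mat_adjoint V \<in> carrier_mat m n" "mat_adjoint V * A \<in> carrier_mat m n"
    using A assms mult_carrier_mat[of "mat_adjoint V" m n A n] by auto
  have "0 \<le> ((mat_adjoint V * A * V) *\<^sub>v v) \<bullet>c v" if v: "v \<in> carrier_vec m" for v
  proof -
    have "((mat_adjoint V * A * V) *\<^sub>v v) \<bullet>c v = (A *\<^sub>v (V *\<^sub>v v)) \<bullet>c (V *\<^sub>v v)"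
      using A(1) assms(2) v c
      by (simp add: assoc_mult_mat_vec[of _ m n] cscalar_mat_adjoint[of _ m n])
    then show ?thesis using A(2)[of "V *\<^sub>v v"] assms(2) v by simp
  qed
  then show ?thesis
    using assms(2) c by (simp add: psd_mat_def mult_carrier_mat[of _ m n])
qed

lemma mat_diag_psd:
  assumes "\<And>i. i < n \<Longrightarrow> 0 \<le> d i"
  shows "mat_diag n (\<lambda>i. complex_of_real (d i)) \<in> psd_mat n"
proof -
  have "0 \<le> (mat_diag n (\<lambda>i. complex_of_real (d i)) *\<^sub>v v) \<bullet>c v" if v: "v \<in> carrier_vec n" for v
  proof -
    have "(mat_diag n (\<lambda>i. complex_of_real (d i)) *\<^sub>v v) \<bullet>c v
        = (\<Sum>i<n. (\<Sum>j<n. (if i = j then of_real (d j) else 0) * v $ j) * cnj (v $ i))"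
      using v by (simp add: scalar_prod_def mat_diag_def atLeast0LessThan)
    also have "\<dots> = of_real (\<Sum>i<n. d i * (cmod (v $ i))\<^sup>2)"
      unfolding of_real_sum of_real_mult complex_norm_square
      by (intro sum.cong) (auto simp: if_distrib[of "\<lambda>x. x * _"] cong: if_cong)
    also have "0 \<le> \<dots>"
      using assms by (auto simp: less_eq_complex_def intro!: sum_nonneg)
    finally show ?thesis .
  qed
  then show ?thesis by (simp add: psd_mat_def)
qed

text \<open>Entrywise, the hypothesis says that \<open>C $$ (i, j) = 0\<close> or
  \<open>d i = e j\<close>, and in either case \<open>g\<close> may be applied. No regularity of
  \<open>g\<close> enters, so no polynomial approximation is required.\<close>

lemma mat_diag_intertwine:
  assumes C: "C \<in> carrier_mat n m"
    and eq: "mat_diag n (\<lambda>i. complex_of_real (d i)) * C = C * mat_diag m (\<lambda>i. of_real (e i))"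
  shows "mat_diag n (\<lambda>i. complex_of_real (g (d i))) * C = C * mat_diag m (\<lambda>i. of_real (g (e i)))"
proof (rule eq_matI)
  fix i j assume "i < dim_row (C * mat_diag m (\<lambda>i. complex_of_real (g (e i))))"
    "j < dim_col (C * mat_diag m (\<lambda>i. complex_of_real (g (e i))))"
  then have ij: "i < n" "j < m" using C by (auto simp: mat_diag_def)
  have "of_real (d i) * C $$ (i, j) = C $$ (i, j) * of_real (e j)"
    using arg_cong[OF eq, of "\<lambda>M. M $$ (i, j)"] ij
    by (simp add: mat_diag_mult_left[OF C] mat_diag_mult_right[OF C])
  then have "d i = e j \<or> C $$ (i, j) = 0" by auto
  then show "(mat_diag n (\<lambda>i. complex_of_real (g (d i))) * C) $$ (i, j) =
      (C * mat_diag m (\<lambda>i. of_real (g (e i)))) $$ (i, j)"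
    using ij by (auto simp: mat_diag_mult_left[OF C] mat_diag_mult_right[OF C])
qed (use C in \<open>auto simp: mat_diag_def\<close>)

text \<open>The change of coordinates \<open>C = mat_adjoint U * B\<close> reduces this to the
  diagonal case. Taking \<open>B\<close> unitary shows that \<open>fun_mat\<close> is well defined;
  taking \<open>B\<close> to be an isometry moves a function of a matrix past it.\<close>

lemma unitary_diag_intertwine:
  assumes U: "unitary_mat n U" and B: "B \<in> carrier_mat n m"
    and eq: "U * mat_diag n (\<lambda>i. complex_of_real (d i)) * mat_adjoint U * B =
      B * mat_diag m (\<lambda>i. of_real (e i))"
  shows "U * mat_diag n (\<lambda>i. complex_of_real (g (d i))) * mat_adjoint U * B =
      B * mat_diag m (\<lambda>i. of_real (g (e i)))"
proof -
  have Uc: "U \<in> carrier_mat n n" "mat_adjoint U \<in> carrier_mat n n"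
    and UU: "mat_adjoint U * U = 1\<^sub>m n" "U * mat_adjoint U = 1\<^sub>m n"
    using U by (auto simp: unitary_mat_def)
  note simps = assoc_mult_mat[of _ n n _ n _ m] assoc_mult_mat[of _ n n _ n _ n]
    assoc_mult_mat[of _ n n _ m _ m] mult_carrier_mat[of _ n n _ n] mult_carrier_mat[of _ n n _ m]
    mult_carrier_mat[of _ n m _ m]
  define C where "C = mat_adjoint U * B"
  have C: "C \<in> carrier_mat n m" using Uc B by (simp add: C_def simps)
  have UC: "U * (C * M) = B * M" if "M \<in> carrier_mat m m" for M
  proof -
    have "U * (C * M) = (U * mat_adjoint U) * (B * M)"
      using Uc B that by (simp add: C_def simps)
    then show ?thesis using B that by (simp add: UU simps left_mult_one_mat[of _ n m])
  qed
  have cancel: "mat_adjoint U * (U * M) = M" if "M \<in> carrier_mat n m" for M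
    using Uc that UU(1) by (simp add: assoc_mult_mat[symmetric, of _ n n _ n _ m])
  have "mat_diag n (\<lambda>i. complex_of_real (d i)) * C = mat_adjoint U * (U * (mat_diag n (\<lambda>i. of_real (d i)) * C))"
    by (rule cancel[symmetric]) (use C in \<open>simp add: simps\<close>)
  also have "U * (mat_diag n (\<lambda>i. of_real (d i)) * C) = B * mat_diag m (\<lambda>i. of_real (e i))"
    using Uc B by (simp add: C_def simps flip: eq)
  also have "mat_adjoint U * \<dots> = C * mat_diag m (\<lambda>i. of_real (e i))"
    using Uc B by (simp add: C_def simps)
  finally have "mat_diag n (\<lambda>i. complex_of_real (g (d i))) * C = C * mat_diag m (\<lambda>i. of_real (g (e i)))"
    by (rule mat_diag_intertwine[OF C])
  then have "U * (mat_diag n (\<lambda>i. complex_of_real (g (d i))) * C) = B * mat_diag m (\<lambda>i. of_real (g (e i)))"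
    by (simp add: UC)
  then show ?thesis using Uc B by (simp add: C_def simps)
qed

text \<open>The definite description needs uniqueness: if \<open>W\<close> and \<open>e\<close> give
  a second diagonalization, then \<open>W\<close> intertwines \<open>A\<close> with the diagonal
  matrix of \<open>e\<close>, hence also the two candidates for \<open>g(A)\<close>.\<close>

lemma fun_mat_eq:
  assumes U: "unitary_mat n U"
    and A: "A = U * mat_diag n (\<lambda>i. complex_of_real (d i)) * mat_adjoint U"
  shows "fun_mat g A = U * mat_diag n (\<lambda>i. of_real (g (d i))) * mat_adjoint U"
proof -
  have Uc: "U \<in> carrier_mat n n" using U by (simp add: unitary_mat_def)
  then have n: "dim_row A = n" by (simp add: A)
  show ?thesis
    unfolding fun_mat_def Let_def n
  proof (rule the_equality)
    fix B
    assume "\<exists>W e. unitary_mat n W \<and> A = W * mat_diag n (\<lambda>i. complex_of_real (e i)) * mat_adjoint W \<and>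
      B = W * mat_diag n (\<lambda>i. complex_of_real (g (e i))) * mat_adjoint W"
    then obtain W and e :: "nat \<Rightarrow> real" where W: "unitary_mat n W"
      and AW: "A = W * mat_diag n (\<lambda>i. complex_of_real (e i)) * mat_adjoint W"
      and B: "B = W * mat_diag n (\<lambda>i. complex_of_real (g (e i))) * mat_adjoint W" by blast
    have Wc: "W \<in> carrier_mat n n" "mat_adjoint W * W = 1\<^sub>m n" "W * mat_adjoint W = 1\<^sub>m n"
      using W by (auto simp: unitary_mat_def)
    note simps = assoc_mult_mat[of _ n n _ n _ n] mult_carrier_mat[of _ n n _ n]
    have "U * mat_diag n (\<lambda>i. complex_of_real (d i)) * mat_adjoint U * W = W * mat_diag n (\<lambda>i. of_real (e i))"
      using Wc by (simp add: A[symmetric] AW simps right_mult_one_mat[of _ n n])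
    from unitary_diag_intertwine[OF U Wc(1) this, of g]
    have "U * mat_diag n (\<lambda>i. complex_of_real (g (d i))) * mat_adjoint U * W * mat_adjoint W =
        W * mat_diag n (\<lambda>i. of_real (g (e i))) * mat_adjoint W" by simp
    then show "B = U * mat_diag n (\<lambda>i. of_real (g (d i))) * mat_adjoint U"
      using Wc Uc by (simp add: B simps)
  qed (use U A in blast)
qed

text \<open>The compression inequality for an isometry \<open>V\<close> and the diagonal matrix
  \<open>X\<close> with entries \<open>l i\<close>. Assumption \<open>t\<close> says that the
  compression of \<open>X^p\<close> is already diagonal, so that its functional calculus is
  explicit.\<close>

theorem ph_convex_compression:
  fixes V :: "complex mat" and l t :: "nat \<Rightarrow> real"
  assumes conv: "operator_ph_convex p h f"
    and n: "1 \<le> n" and V: "V \<in> carrier_mat n m" "mat_adjoint V * V = 1\<^sub>m m"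
    and l: "\<And>i. i < n \<Longrightarrow> 0 \<le> l i"
    and t: "mat_adjoint V * mat_diag n (\<lambda>i. of_real (l i powr p)) * V = mat_diag m (\<lambda>i. of_real (t i))"
  shows "of_real (2 * h (1 / 2)) \<cdot>\<^sub>m (mat_adjoint V * mat_diag n (\<lambda>i. of_real (f (l i))) * V) -
    mat_diag m (\<lambda>i. of_real (f (t i powr (1 / p)))) \<in> psd_mat m"
proof -
  have Va: "mat_adjoint V \<in> carrier_mat m n" using V by simp
  note simps = assoc_mult_mat[of _ n n _ n _ n] assoc_mult_mat[of _ n n _ n _ m]
    assoc_mult_mat[of _ n n _ m _ m] assoc_mult_mat[of _ n n _ m _ n] assoc_mult_mat[of _ n m _ n _ n] assoc_mult_mat[of _ n m _ n _ m]
    assoc_mult_mat[of _ m n _ n _ n] assoc_mult_mat[of _ m n _ n _ m] assoc_mult_mat[of _ m n _ m _ m]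
    assoc_mult_mat[of _ n m _ m _ n] assoc_mult_mat[of _ n m _ m _ m]
    mult_carrier_mat[of _ n n _ n] mult_carrier_mat[of _ n n _ m] mult_carrier_mat[of _ n m _ m]
    mult_carrier_mat[of _ n m _ n] mult_carrier_mat[of _ m n _ n] mult_carrier_mat[of _ m n _ m] mult_carrier_mat[of _ m m _ n]
  \<comment> \<open>The reflection that fixes the range of \<open>V\<close> and negates its
    orthogonal complement.\<close>
  define W where "W = 2 \<cdot>\<^sub>m (V * mat_adjoint V) - 1\<^sub>m n"
  have W: "W \<in> carrier_mat n n" using V Va by (simp add: W_def simps minus_carrier_mat[of _ n n])
  have Wadj: "mat_adjoint W = W"
    using V Va unfolding W_def
    by (simp add: mat_adjoint_minus[of _ n n] mat_adjoint_smult mat_adjoint_mult[of _ n m _ n] simps)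
  have Wmult: "W * M = 2 \<cdot>\<^sub>m (V * (mat_adjoint V * M)) - M" if "M \<in> carrier_mat n k" for M k
    using V Va that unfolding W_def
    by (simp add: minus_mult_distrib_mat[of _ n n _ _ k] mult_smult_assoc_mat[of _ n n _ k]
        assoc_mult_mat[of _ n m _ n _ k] mult_carrier_mat[of _ n m _ n])
  have WV: "W * V = V"
    using V Va unfolding Wmult[OF V(1)] by (intro eq_matI) auto
  have VW: "mat_adjoint V * W = mat_adjoint V"
    using mat_adjoint_mult[OF W V(1)] by (simp add: WV Wadj)
  have "W * W = 1\<^sub>m n"
    using V Va unfolding Wmult[OF W] VW by (intro eq_matI) (auto simp: W_def)
  then have Wu: "unitary_mat n W" using W by (simp add: unitary_mat_def Wadj)
  \<comment> \<open>\<open>X g\<close> is \<open>g(X)\<close>, so \<open>X id\<close> is the matrix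
    itself. As \<open>W\<close> is unitary and self-adjoint,
    \<open>g(W X W) = W g(X) W\<close>.\<close>
  define X where "X g = mat_diag n (\<lambda>i. complex_of_real (g (l i)))" for g :: "real \<Rightarrow> real"
  have X: "X g \<in> carrier_mat n n" for g by (simp add: X_def)
  have fun_X: "fun_mat g (X id) = X g" for g
    using fun_mat_eq[of n "1\<^sub>m n" "X id" l g] by (simp add: unitary_mat_def X_def left_mult_one_mat[of _ n n] right_mult_one_mat[of _ n n])
  have fun_WXW: "fun_mat g (W * X id * W) = W * X g * W" for g
    using fun_mat_eq[OF Wu, of "W * X id * W" l g] by (simp add: X_def Wadj)
  have X_psd: "X id \<in> psd_mat n" using l by (auto simp: X_def intro: mat_diag_psd)
  have WXW_psd: "W * X id * W \<in> psd_mat n" using psd_mat_congruence[OF X_psd W] by (simp add: Wadj)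
  let ?P = "\<lambda>x. x powr p"
  \<comment> \<open>The mean of the p-th powers of \<open>X\<close> and \<open>W X W\<close> at
    \<alpha> = 1/2, in the form that the convexity definition produces.\<close>
  define M where "M = of_real (1 / 2) \<cdot>\<^sub>m X ?P + of_real (1 - 1 / 2) \<cdot>\<^sub>m (W * X ?P * W)"
  have M: "M \<in> carrier_mat n n" using W X by (simp add: M_def simps)
  have X_adj: "mat_adjoint (X g) = X g" for g by (simp add: X_def)
  have "mat_adjoint M = M"
    using W X unfolding M_def
    by (simp add: mat_adjoint_add[of _ n n] mat_adjoint_smult mat_adjoint_mult[of _ n n _ n] simps Wadj X_adj)
  then obtain Z and e :: "nat \<Rightarrow> real" where Z: "unitary_mat n Z"
    and MZ: "M = Z * mat_diag n (\<lambda>i. of_real (e i)) * mat_adjoint Z"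
    using hermitian_unitary_diagonalization[OF M] by blast
  have Zc: "Z \<in> carrier_mat n n" using Z by (simp add: unitary_mat_def)
  define G where "G = fun_mat f (fun_mat (\<lambda>x. x powr (1 / p)) M)"
  have G: "G = Z * mat_diag n (\<lambda>i. of_real (f (e i powr (1 / p)))) * mat_adjoint Z"
    unfolding G_def fun_mat_eq[OF Z MZ] by (rule fun_mat_eq[OF Z refl])
  have Gc: "G \<in> carrier_mat n n" unfolding G using Zc by (simp add: simps)
  have XV: "X ?P * V \<in> carrier_mat n m" using X V by (simp add: simps)
  \<comment> \<open>Since \<open>W * V = V\<close>, this is the reflection applied to
    \<open>X ?P * V\<close>, whose projection to the range of \<open>V\<close> is known from
    \<open>t\<close>. In the mean the terms \<open>X ?P * V\<close> cancel, which leaves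
    \<open>M * V = V * diag(t)\<close>: the range of \<open>V\<close> is invariant under
    \<open>M\<close>.\<close>
  have "W * X ?P * W * V = 2 \<cdot>\<^sub>m (V * mat_diag m (\<lambda>i. of_real (t i))) - X ?P * V"
    using Wmult[OF XV] W X V Va t by (simp add: simps WV X_def)
  then have "M * V = of_real (1 / 2) \<cdot>\<^sub>m (X ?P * V) +
      of_real (1 / 2) \<cdot>\<^sub>m (2 \<cdot>\<^sub>m (V * mat_diag m (\<lambda>i. of_real (t i))) - X ?P * V)"
    unfolding M_def using W X V Va XV
    by (simp add: add_mult_distrib_mat[of _ n n _ _ m] mult_smult_assoc_mat[of _ n n _ m] simps)
  also have "\<dots> = V * mat_diag m (\<lambda>i. of_real (t i))"
  proof -
    have half: "of_real (1 / 2) \<cdot>\<^sub>m Y + of_real (1 / 2) \<cdot>\<^sub>m (2 \<cdot>\<^sub>m S - Y) = S"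
      if "Y \<in> carrier_mat n m" "S \<in> carrier_mat n m" for Y S :: "complex mat"
      using that by (intro eq_matI) (auto simp: field_simps)
    show ?thesis by (rule half[OF XV]) (use V in \<open>simp add: simps\<close>)
  qed
  finally have "M * V = V * mat_diag m (\<lambda>i. of_real (t i))" .
  \<comment> \<open>Both functional calculi combine into the single function
    \<open>f (x powr (1 / p))\<close>, to which the intertwining relation of \<open>M\<close> and
    \<open>V\<close> transfers.\<close>
  then have GV: "G * V = V * mat_diag m (\<lambda>i. of_real (f (t i powr (1 / p))))"
    unfolding MZ G
    using unitary_diag_intertwine[OF Z V(1), of e t "\<lambda>x. f (x powr (1 / p))"] by simp
  then have VGV: "mat_adjoint V * G * V = mat_diag m (\<lambda>i. of_real (f (t i powr (1 / p))))"
    using V Va Gc by (simp add: simps) (simp add: V left_mult_one_mat[of _ m m] assoc_mult_mat[symmetric, of _ m n _ m _ m])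
  \<comment> \<open>The right side of the convexity inequality minus its left side. Compressed by
    \<open>V\<close>, its two terms with factor \<open>h (1 / 2)\<close> become equal because
    \<open>W\<close> fixes the range of \<open>V\<close>; this is the origin of
    \<open>2 * h (1 / 2)\<close>.\<close>
  define L where "L = of_real (h (1 / 2)) \<cdot>\<^sub>m X f + of_real (h (1 / 2)) \<cdot>\<^sub>m (W * X f * W) - G"
  have "le_mat n G (of_real (h (1 / 2)) \<cdot>\<^sub>m X f + of_real (h (1 - 1 / 2)) \<cdot>\<^sub>m (W * X f * W))"
    using conv[unfolded operator_ph_convex_def, THEN conjunct2, THEN conjunct2,
        rule_format, OF n X_psd WXW_psd, of "1 / 2"]
    by (simp add: fun_X fun_WXW G_def M_def)
  then have L: "L \<in> psd_mat n" by (simp add: le_mat_def L_def)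
  have "mat_adjoint V * L * V = of_real (2 * h (1 / 2)) \<cdot>\<^sub>m (mat_adjoint V * X f * V) -
      mat_adjoint V * G * V"
  proof -
    have "mat_adjoint V * (W * X f * W) * V = (mat_adjoint V * W) * X f * (W * V)"
      using V(1) Va X W by (simp add: simps)
    then have VWX: "mat_adjoint V * (W * X f * W) * V = mat_adjoint V * X f * V"
      by (simp add: VW WV)
    let ?c = "complex_of_real (h (1 / 2))"
    have "mat_adjoint V * L * V = ?c \<cdot>\<^sub>m (mat_adjoint V * X f * V) +
      ?c \<cdot>\<^sub>m (mat_adjoint V * (W * X f * W) * V) - mat_adjoint V * G * V"
      unfolding L_def using V(1) Va X W Gc
      by (simp add: mult_minus_distrib_mat[of _ m n _ n] mult_add_distrib_mat[of _ m n _ n]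
          mult_smult_distrib[of _ m n _ n] minus_mult_distrib_mat[of _ m n _ _ m] add_mult_distrib_mat[of _ m n _ _ m]
          mult_smult_assoc_mat[of _ m n _ m] mult_carrier_mat[of _ m n _ n] mult_carrier_mat[of _ n n _ n])
    also have "\<dots> = of_real (2 * h (1 / 2)) \<cdot>\<^sub>m (mat_adjoint V * X f * V) - mat_adjoint V * G * V"
      unfolding VWX using V(1) Va X Gc by (intro eq_matI) (simp_all del: index_mult_mat(1) add: algebra_simps)
    finally show ?thesis .
  qed
  then show ?thesis
    using psd_mat_congruence[OF L V(1)] by (simp add: VGV X_def)
qed

section \<open>Spectral theorem on finite-dimensional Hilbert spaces\<close>

lemma BH_iff: "T \<in> BH \<longleftrightarrow> (\<forall>x y. T (x + y) = T x + T y) \<and> (\<forall>c x. T (c *\<^sub>C x) = c *\<^sub>C T x)"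
  by (auto simp: BH_def Vector_Spaces.linear_iff cvec.vector_space_axioms)

lemma BH_add: "T \<in> BH \<Longrightarrow> T (x + y) = T x + T y"
  and BH_scaleC: "T \<in> BH \<Longrightarrow> T (c *\<^sub>C x) = c *\<^sub>C T x"
  by (simp_all add: BH_iff)

lemma BH_zero: "T \<in> BH \<Longrightarrow> T 0 = 0"
  using BH_scaleC[of T 0 0] by simp

lemma BH_sum: "T \<in> BH \<Longrightarrow> T (\<Sum>i\<in>I. x i) = (\<Sum>i\<in>I. T (x i))"
  by (induction I rule: infinite_finite_induct) (simp_all add: BH_zero BH_add)

lemma cinner_zero_left [simp]: "cinner 0 x = 0"
  using cinner_scaleC_left[of 0 0 x] by simp

lemma cinner_zero_right [simp]: "cinner x 0 = 0"
  using cinner_commute[of x 0] by simp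

lemma cinner_add_right: "cinner x (y + z) = cinner x y + cinner x z"
  using cinner_commute[of x "y + z"] cinner_commute[of x y] cinner_commute[of x z]
  by (simp add: cinner_add_left)

lemma cinner_scaleC_right: "cinner x (a *\<^sub>C y) = cnj a * cinner x y"
  using cinner_commute[of x "a *\<^sub>C y"] cinner_commute[of x y] by (simp add: cinner_scaleC_left)

lemma cinner_diff_left: "cinner (x - y) z = cinner x z - cinner y z"
  using cinner_add_left[of "x - y" y z] by simp

lemma cinner_sum_left: "cinner (\<Sum>i\<in>I. x i) y = (\<Sum>i\<in>I. cinner (x i) y)"
  by (induction I rule: infinite_finite_induct) (simp_all add: cinner_add_left)

lemma cinner_sum_right: "cinner y (\<Sum>i\<in>I. x i) = (\<Sum>i\<in>I. cinner y (x i))"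
  by (induction I rule: infinite_finite_induct) (simp_all add: cinner_add_right)

text \<open>Indexing by an initial segment of the naturals lets coordinates serve as matrix indices;
  \<open>n = 0\<close> accounts for the zero space.\<close>

definition orthonormal_family :: "nat \<Rightarrow> (nat \<Rightarrow> 'a::fin_dim_hilbert) \<Rightarrow> bool" where
  "orthonormal_family n e \<longleftrightarrow> (\<forall>i<n. \<forall>j<n. cinner (e i) (e j) = (if i = j then 1 else 0))"

definition orthonormal_basis :: "nat \<Rightarrow> (nat \<Rightarrow> 'a::fin_dim_hilbert) \<Rightarrow> bool" where
  "orthonormal_basis n e \<longleftrightarrow>
    orthonormal_family n e \<and> (\<forall>v. v = (\<Sum>i<n. cinner v (e i) *\<^sub>C e i))"

lemma cinner_orthonormal_sum:
  assumes "orthonormal_family n e" "j < n"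
  shows "cinner (\<Sum>i<n. c i *\<^sub>C e i) (e j) = c j"
proof -
  have "cinner (\<Sum>i<n. c i *\<^sub>C e i) (e j) = (\<Sum>i<n. if i = j then c i else 0)"
    unfolding cinner_sum_left cinner_scaleC_left
    using assms by (intro sum.cong) (auto simp: orthonormal_family_def)
  then show ?thesis using assms(2) by simp
qed

text \<open>Orthonormal vectors are independent, so a finite spanning set bounds their number. This
  makes an orthonormal family of maximal size available.\<close>

lemma finite_orthonormal_family_sizes:
  "finite {n. \<exists>e :: nat \<Rightarrow> 'a::fin_dim_hilbert. orthonormal_family n e}"
proof -
  obtain B :: "'a set" where B: "finite B" "\<forall>x. \<exists>c. x = (\<Sum>b\<in>B. c b *\<^sub>C b)"
    using finite_spanning_set by blast
  have span: "x \<in> cvec.span B" for x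
  proof -
    obtain c where "x = (\<Sum>b\<in>B. c b *\<^sub>C b)" using B(2) by blast
    then show ?thesis by (simp add: cvec.span_base cvec.span_scale cvec.span_sum)
  qed
  have "n \<le> card B" if e: "orthonormal_family n e" for n and e :: "nat \<Rightarrow> 'a"
  proof -
    have inj: "inj_on e {..<n}"
      using e by (auto simp: orthonormal_family_def inj_on_def) (metis zero_neq_one)
    have "cvec.independent (e ` {..<n})"
    proof (rule cvec.independent_if_scalars_zero)
      fix c x
      assume c: "(\<Sum>x\<in>e ` {..<n}. c x *\<^sub>C x) = 0" and "x \<in> e ` {..<n}"
      then obtain j where j: "j < n" "x = e j" by auto
      have "(\<Sum>i<n. c (e i) *\<^sub>C e i) = 0" using c by (simp add: sum.reindex[OF inj])
      then show "c x = 0" using cinner_orthonormal_sum[OF e j(1), of "\<lambda>i. c (e i)"] j by simp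
    qed simp
    then have "card (e ` {..<n}) \<le> card B"
      using cvec.independent_span_bound[OF B(1), of "e ` {..<n}"] span by blast
    then show ?thesis using card_image[OF inj] by simp
  qed
  then have "{n. \<exists>e :: nat \<Rightarrow> 'a. orthonormal_family n e} \<subseteq> {..card B}" by auto
  then show ?thesis by (rule finite_subset) simp
qed

lemma cinner_self_pos:
  assumes "x \<noteq> 0"
  obtains r where "r > 0" "cinner x x = complex_of_real r"
  using assms cinner_ge_zero[of x] cinner_eq_zero_iff[of x]
  by (intro that[of "Re (cinner x x)"]) (auto simp: complex_eq_iff less_eq_complex_def)

text \<open>An orthonormal family of maximal size is a basis: if some \<open>v\<close> differed from
  its expansion, the normalized remainder would extend the family.\<close>

lemma exists_orthonormal_basis:
  obtains n and e :: "nat \<Rightarrow> 'a::fin_dim_hilbert" where "orthonormal_basis n e"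
proof -
  define K where "K = {n. \<exists>e :: nat \<Rightarrow> 'a. orthonormal_family n e}"
  have fin: "finite K" unfolding K_def by (rule finite_orthonormal_family_sizes)
  have "0 \<in> K" by (simp add: K_def orthonormal_family_def)
  define n where "n = Max K"
  have "n \<in> K" using Max_in[OF fin] \<open>0 \<in> K\<close> by (auto simp: n_def)
  then obtain e :: "nat \<Rightarrow> 'a" where e: "orthonormal_family n e" by (auto simp: K_def)
  have "v = (\<Sum>i<n. cinner v (e i) *\<^sub>C e i)" for v
  proof (rule ccontr)
    define x where "x = v - (\<Sum>i<n. cinner v (e i) *\<^sub>C e i)"
    assume "v \<noteq> (\<Sum>i<n. cinner v (e i) *\<^sub>C e i)"
    then have "x \<noteq> 0" by (simp add: x_def)
    then obtain r where r: "r > 0" "cinner x x = complex_of_real r" by (rule cinner_self_pos)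
    have xe: "cinner x (e j) = 0" "cinner (e j) x = 0" if "j < n" for j
    proof -
      show "cinner x (e j) = 0"
        using cinner_orthonormal_sum[OF e that] by (simp add: x_def cinner_diff_left)
      then show "cinner (e j) x = 0" using cinner_commute[of "e j" x] by simp
    qed
    define y where "y = complex_of_real (1 / sqrt r) *\<^sub>C x"
    have "cinner y y = 1"
      using r by (simp add: y_def cinner_scaleC_left cinner_scaleC_right flip: of_real_mult)
    then have "orthonormal_family (Suc n) (e(n := y))"
      using e xe by (auto simp: orthonormal_family_def y_def less_Suc_eq cinner_scaleC_left cinner_scaleC_right)
    then have "Suc n \<in> K" by (auto simp: K_def)
    then have "Suc n \<le> n" unfolding n_def by (rule Max_ge[OF fin])
    then show False by simp
  qed
  then show ?thesis using e that by (auto simp: orthonormal_basis_def)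
qed

section \<open>Coordinates with respect to an orthonormal basis\<close>

context
  fixes n :: nat and e :: "nat \<Rightarrow> 'a::fin_dim_hilbert"
  assumes onb: "orthonormal_basis n e"
begin

lemma onb_family: "orthonormal_family n e"
  using onb by (simp add: orthonormal_basis_def)

lemma onb_expand: "(\<Sum>i<n. cinner v (e i) *\<^sub>C e i) = v"
  using onb by (simp add: orthonormal_basis_def)

lemma onb_eqI:
  assumes "\<And>i. i < n \<Longrightarrow> cinner v (e i) = cinner w (e i)"
  shows "v = w"
proof -
  have "(\<Sum>i<n. cinner v (e i) *\<^sub>C e i) = (\<Sum>i<n. cinner w (e i) *\<^sub>C e i)"
    using assms by (intro sum.cong) auto
  then show ?thesis by (simp only: onb_expand)
qed

lemma onb_cinner: "cinner v w = (\<Sum>i<n. cinner v (e i) * cnj (cinner w (e i)))"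
proof -
  have "cinner v w = cinner v (\<Sum>i<n. cinner w (e i) *\<^sub>C e i)" by (simp add: onb_expand)
  then show ?thesis by (simp add: cinner_sum_right cinner_scaleC_right mult.commute)
qed

lemma BH_onb_expand:
  assumes "T \<in> BH"
  shows "T v = (\<Sum>i<n. cinner v (e i) *\<^sub>C T (e i))"
proof -
  have "T v = T (\<Sum>i<n. cinner v (e i) *\<^sub>C e i)" by (simp add: onb_expand)
  then show ?thesis by (simp add: BH_sum[OF assms] BH_scaleC[OF assms])
qed

lemma eigenbasis_cinner:
  assumes "T \<in> BH" "\<And>i. i < n \<Longrightarrow> T (e i) = d i *\<^sub>C e i" "j < n"
  shows "cinner (T v) (e j) = d j * cinner v (e j)"
proof -
  have "T v = (\<Sum>i<n. (cinner v (e i) * d i) *\<^sub>C e i)"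
    using assms(2) by (subst BH_onb_expand[OF assms(1)]) (simp add: scaleC_scaleC)
  then show ?thesis by (simp add: cinner_orthonormal_sum[OF onb_family assms(3)])
qed

text \<open>Removes spectrum and projections from the functional calculus. Eigenvalues may repeat in
  \<open>d\<close>, while \<open>fun_op\<close> sums over distinct ones, so the basis vectors are
  grouped by eigenvalue.\<close>

lemma fun_op_eigenbasis:
  assumes T: "T \<in> BH" and eig: "\<And>i. i < n \<Longrightarrow> T (e i) = complex_of_real (d i) *\<^sub>C e i"
  shows "fun_op g T v = (\<Sum>i<n. (complex_of_real (g (d i)) * cinner v (e i)) *\<^sub>C e i)"
proof -
  note Te = eigenbasis_cinner[OF T eig]
  have ne: "e i \<noteq> 0" if "i < n" for i
    using onb_family that by (auto simp: orthonormal_family_def dest!: spec[of _ i])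
  have spec: "spectrum_op T = (\<lambda>i. complex_of_real (d i)) ` {..<n}"
  proof (intro equalityI subsetI)
    fix l assume "l \<in> spectrum_op T"
    then obtain v where v: "v \<noteq> 0" "T v = l *\<^sub>C v" by (auto simp: spectrum_op_def)
    then obtain j where j: "j < n" "cinner v (e j) \<noteq> 0" using onb_eqI[of v 0] by auto
    then have "l = of_real (d j)"
      using Te[OF _ j(1), of v] v(2) by (simp add: cinner_scaleC_left)
    then show "l \<in> (\<lambda>i. complex_of_real (d i)) ` {..<n}" using j by auto
  next
    fix l assume "l \<in> (\<lambda>i. complex_of_real (d i)) ` {..<n}"
    then obtain i where "i < n" "l = of_real (d i)" by auto
    then show "l \<in> spectrum_op T" unfolding spectrum_op_def using eig[of i] ne[of i] by blast
  qed
  \<comment> \<open>Projecting to an eigenspace keeps exactly the coordinates whose basis vectors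
    have that eigenvalue. Uniqueness holds because the difference of two candidates lies in the
    eigenspace and is orthogonal to it.\<close>
  have proj: "orth_proj (eigenspace T (of_real x)) v =
      (\<Sum>i<n. (if d i = x then cinner v (e i) else 0) *\<^sub>C e i)" (is "_ = ?w") for x
    unfolding orth_proj_def
  proof (rule the_equality)
    have wj: "cinner ?w (e j) = (if d j = x then cinner v (e j) else 0)" if "j < n" for j
      by (rule cinner_orthonormal_sum[OF onb_family that])
    have "T ?w = of_real x *\<^sub>C ?w"
      by (rule onb_eqI) (auto simp: Te wj cinner_scaleC_left)
    then have w: "?w \<in> eigenspace T (of_real x)" by (simp add: eigenspace_def)
    have perp: "cinner (v - ?w) u = 0" if "u \<in> eigenspace T (of_real x)" for u
    proof -
      have "cinner u (e i) = 0" if "i < n" "d i \<noteq> x" for i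
        using Te[OF _ that(1), of u] \<open>u \<in> _\<close> that(2) by (simp add: eigenspace_def cinner_scaleC_left)
      then have "cinner (v - ?w) (e i) * cnj (cinner u (e i)) = 0" if "i < n" for i
        using that by (cases "d i = x") (simp_all add: cinner_diff_left wj)
      then show ?thesis unfolding onb_cinner[of "v - ?w" u] by (intro sum.neutral) blast
    qed
    show "?w \<in> eigenspace T (of_real x) \<and> (\<forall>u\<in>eigenspace T (of_real x). cinner (v - ?w) u = 0)"
      using w perp by blast
    fix w' assume w': "w' \<in> eigenspace T (of_real x) \<and> (\<forall>u\<in>eigenspace T (of_real x). cinner (v - w') u = 0)"
    have "w' - ?w \<in> eigenspace T (of_real x)"
      using w w' BH_add[OF T, of "w' - ?w" ?w]
      by (simp add: eigenspace_def cvec.scale_right_diff_distrib)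
    then have "cinner (v - ?w) (w' - ?w) - cinner (v - w') (w' - ?w) = 0"
      using w' perp by simp
    then have "cinner (w' - ?w) (w' - ?w) = 0"
      by (simp add: cinner_diff_left)
    then show "w' = ?w" by (simp add: cinner_eq_zero_iff)
  qed
  let ?F = "\<lambda>i. (complex_of_real (g (d i)) * cinner v (e i)) *\<^sub>C e i"
  have "fun_op g T v = (\<Sum>l\<in>(\<lambda>i. complex_of_real (d i)) ` {..<n}. \<Sum>i | i \<in> {..<n} \<and> complex_of_real (d i) = l. ?F i)"
    unfolding fun_op_def spec
  proof (rule sum.cong[OF refl], clarify)
    fix k assume "k < n"
    have "complex_of_real (g (Re (of_real (d k)))) *\<^sub>C orth_proj (eigenspace T (of_real (d k))) v
        = (\<Sum>i<n. if d i = d k then ?F i else 0)"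
      unfolding proj cvec.scale_sum_right by (intro sum.cong) (auto simp: scaleC_scaleC)
    also have "\<dots> = (\<Sum>i | i \<in> {..<n} \<and> complex_of_real (d i) = complex_of_real (d k). ?F i)"
      by (subst sum.inter_filter[symmetric]) auto
    finally show "complex_of_real (g (Re (of_real (d k)))) *\<^sub>C orth_proj (eigenspace T (of_real (d k))) v
        = (\<Sum>i | i \<in> {..<n} \<and> complex_of_real (d i) = complex_of_real (d k). ?F i)" .
  qed
  also have "\<dots> = (\<Sum>i<n. ?F i)"
    by (rule sum.image_gen[symmetric]) simp
  finally show ?thesis .
qed

text \<open>Expansion in the basis turns \<open>cinner (S v) v\<close> into the quadratic form of
  the matrix at the coordinate vector of \<open>v\<close>.\<close>

lemma positive_op_matrixI:
  assumes S: "S \<in> BH" and psd: "mat n n (\<lambda>(i, j). cinner (S (e j)) (e i)) \<in> psd_mat n"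
  shows "positive_op S"
proof -
  have "0 \<le> cinner (S v) v" for v
  proof -
    define w where "w = vec n (\<lambda>j. cinner v (e j))"
    have "cinner (S v) v = (\<Sum>i<n. (\<Sum>j<n. cinner v (e j) * cinner (S (e j)) (e i)) * cnj (cinner v (e i)))"
      by (subst onb_cinner, subst BH_onb_expand[OF S]) (simp add: cinner_sum_left cinner_scaleC_left)
    also have "\<dots> = (mat n n (\<lambda>(i, j). cinner (S (e j)) (e i)) *\<^sub>v w) \<bullet>c w"
      by (simp add: w_def scalar_prod_def atLeast0LessThan mult.commute)
    also have "0 \<le> \<dots>" using psd by (auto simp: psd_mat_def w_def)
    finally show ?thesis .
  qed
  then show ?thesis using S by (simp add: positive_op_def)
qed

end

text \<open>Polarization: the quadratic form is real at \<open>x + y\<close>, which relates the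
  imaginary parts, and at \<open>x + \<i> *\<^sub>C y\<close>, which relates the real parts.\<close>

lemma positive_op_symmetric:
  assumes "positive_op T"
  shows "cinner (T x) y = cnj (cinner (T y) x)"
proof -
  have T: "T \<in> BH" and re: "Im (cinner (T v) v) = 0" for v
    using assms by (auto simp: positive_op_def less_eq_complex_def)
  have "Im (cinner (T x) y) + Im (cinner (T y) x) = 0"
    using re[of "x + y"] re[of x] re[of y]
    by (simp add: BH_add[OF T] cinner_add_left cinner_add_right)
  moreover have "Re (cinner (T x) y) = Re (cinner (T y) x)"
    using re[of "x + \<i> *\<^sub>C y"] re[of x] re[of y]
    by (simp add: BH_add[OF T] BH_scaleC[OF T] cinner_add_left cinner_add_right
        cinner_scaleC_left cinner_scaleC_right)
  ultimately show ?thesis by (simp add: complex_eq_iff)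
qed

text \<open>The matrix of \<open>T\<close> in the basis \<open>b\<close> is Hermitian; the columns
  of a diagonalizing unitary are the coordinates of the eigenvectors. Orthonormality and
  completeness of \<open>e\<close> are the two unitarity equations.\<close>

theorem positive_op_eigenbasis:
  fixes T :: "'a::fin_dim_hilbert \<Rightarrow> 'a" and b :: "nat \<Rightarrow> 'a"
  assumes onb: "orthonormal_basis n b" and pos: "positive_op T"
  obtains e d where "orthonormal_basis n e"
    "\<And>i. i < n \<Longrightarrow> T (e i) = complex_of_real (d i) *\<^sub>C e i" "\<And>i. i < n \<Longrightarrow> 0 \<le> d i"
proof -
  have T: "T \<in> BH" and ge: "\<And>v. 0 \<le> cinner (T v) v" using pos by (auto simp: positive_op_def)
  define A where "A = mat n n (\<lambda>(i, j). cinner (T (b j)) (b i))"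
  have A: "A \<in> carrier_mat n n" by (simp add: A_def)
  have "mat_adjoint A = A"
    by (rule eq_matI) (auto simp: A_def positive_op_symmetric[OF pos, symmetric])
  then obtain U and d :: "nat \<Rightarrow> real" where U: "unitary_mat n U"
    and AU: "A = U * mat_diag n (\<lambda>i. of_real (d i)) * mat_adjoint U"
    using hermitian_unitary_diagonalization[OF A] by blast
  have Uc: "U \<in> carrier_mat n n" and UU: "mat_adjoint U * U = 1\<^sub>m n" "U * mat_adjoint U = 1\<^sub>m n"
    using U by (auto simp: unitary_mat_def)
  define e where "e j = (\<Sum>i<n. U $$ (i, j) *\<^sub>C b i)" for j
  have eb: "cinner (e j) (b i) = U $$ (i, j)" if "i < n" for i j
    unfolding e_def by (rule cinner_orthonormal_sum[OF onb_family[OF onb] that])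
  have fam: "orthonormal_family n e"
    unfolding orthonormal_family_def
  proof (intro allI impI)
    fix i j assume ij: "i < n" "j < n"
    have "cinner (e i) (e j) = (\<Sum>k<n. U $$ (k, i) * cnj (U $$ (k, j)))"
      by (subst onb_cinner[OF onb]) (simp add: eb)
    also have "\<dots> = (mat_adjoint U * U) $$ (j, i)"
      using ij Uc by (simp add: scalar_prod_def atLeast0LessThan mult.commute)
    finally show "cinner (e i) (e j) = (if i = j then 1 else 0)" using ij by (auto simp: UU)
  qed
  have "v = (\<Sum>j<n. cinner v (e j) *\<^sub>C e j)" for v
  proof (rule onb_eqI[OF onb])
    fix i assume i: "i < n"
    have "cinner (\<Sum>j<n. cinner v (e j) *\<^sub>C e j) (b i) =
        (\<Sum>j<n. (\<Sum>k<n. cinner v (b k) * cnj (U $$ (k, j))) * U $$ (i, j))"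
      using i by (simp add: cinner_sum_left cinner_scaleC_left eb onb_cinner[OF onb, of v "e _"])
    also have "\<dots> = (\<Sum>k<n. cinner v (b k) * (\<Sum>j<n. U $$ (i, j) * cnj (U $$ (k, j))))"
      unfolding sum_distrib_right sum_distrib_left by (subst sum.swap) (simp add: mult_ac)
    also have "\<dots> = (\<Sum>k<n. cinner v (b k) * (U * mat_adjoint U) $$ (i, k))"
      using i Uc by (intro sum.cong) (simp_all add: scalar_prod_def atLeast0LessThan)
    also have "\<dots> = cinner v (b i)"
      using i by (simp add: UU if_distrib[of "\<lambda>x. _ * x"] cong: if_cong)
    finally show "cinner v (b i) = cinner (\<Sum>j<n. cinner v (e j) *\<^sub>C e j) (b i)" by simp
  qed
  then have e: "orthonormal_basis n e" using fam by (simp add: orthonormal_basis_def)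
  have AUD: "A * U = U * mat_diag n (\<lambda>i. of_real (d i))"
    using Uc by (simp add: AU assoc_mult_mat[of _ n n _ n _ n] mult_carrier_mat[of _ n n _ n] UU
        right_mult_one_mat[of _ n n])
  have eig: "T (e j) = complex_of_real (d j) *\<^sub>C e j" if j: "j < n" for j
  proof (rule onb_eqI[OF onb])
    fix i assume i: "i < n"
    have "cinner (T (e j)) (b i) = (\<Sum>k<n. A $$ (i, k) * U $$ (k, j))"
      using i by (subst BH_onb_expand[OF onb T])
        (simp add: cinner_sum_left cinner_scaleC_left eb A_def mult.commute)
    also have "\<dots> = (A * U) $$ (i, j)"
      using i j A Uc by (simp add: scalar_prod_def atLeast0LessThan)
    also have "\<dots> = cinner (complex_of_real (d j) *\<^sub>C e j) (b i)"
      using i j by (simp add: AUD mat_diag_mult_right[OF Uc] cinner_scaleC_left eb)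
    finally show "cinner (T (e j)) (b i) = cinner (complex_of_real (d j) *\<^sub>C e j) (b i)" .
  qed
  have "0 \<le> d i" if i: "i < n" for i
    using ge[of "e i"] fam i
    by (simp add: eig cinner_scaleC_left orthonormal_family_def less_eq_complex_def)
  then show ?thesis using e eig that by blast
qed

section \<open>Positive linear maps\<close>

lemma BH_diff_scale:
  assumes "S \<in> BH" "T \<in> BH"
  shows "(\<lambda>v. c *\<^sub>C S v - T v) \<in> BH"
  using assms by (auto simp: BH_iff scaleC_add_right cvec.scale_right_diff_distrib scaleC_scaleC mult.commute)

lemma BH_id: "(\<lambda>v. v) \<in> BH"
  by (simp add: BH_iff)

lemma BH_sum_scale:
  assumes "\<And>i. i \<in> I \<Longrightarrow> S i \<in> BH"
  shows "(\<lambda>v. \<Sum>i\<in>I. c i *\<^sub>C S i v) \<in> BH"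
  using assms
  by (auto simp: BH_iff scaleC_add_right scaleC_scaleC mult.commute cvec.scale_sum_right
      simp flip: sum.distrib intro!: sum.cong)

lemma positive_op_sum_scale:
  assumes "\<And>i. i \<in> I \<Longrightarrow> positive_op (S i)" "\<And>i. i \<in> I \<Longrightarrow> 0 \<le> c i"
  shows "positive_op (\<lambda>v. \<Sum>i\<in>I. complex_of_real (c i) *\<^sub>C S i v)"
  using assms
  by (auto simp: positive_op_def cinner_sum_left cinner_scaleC_left less_eq_complex_def BH_sum_scale
      intro!: sum_nonneg)

lemma unital_positive_linear_map_sum:
  assumes \<Phi>: "unital_positive_linear_map \<Phi>" and S: "\<And>i. i < (k::nat) \<Longrightarrow> S i \<in> BH"
  shows "\<Phi> (\<lambda>v. \<Sum>i<k. c i *\<^sub>C S i v) = (\<lambda>v. \<Sum>i<k. c i *\<^sub>C \<Phi> (S i) v)"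
  using S
proof (induction k)
  case 0
  \<comment> \<open>The empty sum requires that \<open>\<Phi>\<close> maps the zero operator to
    itself, which is homogeneity with factor 0.\<close>
  have "\<forall>c. \<forall>T\<in>BH. \<Phi> (\<lambda>v. c *\<^sub>C T v) = (\<lambda>v. c *\<^sub>C \<Phi> T v)"
    using \<Phi> by (simp add: unital_positive_linear_map_def)
  from bspec[OF spec[OF this, of 0] BH_id] show ?case by simp
next
  case (Suc k)
  have "\<Phi> (\<lambda>v. (\<Sum>i<k. c i *\<^sub>C S i v) + c k *\<^sub>C S k v)
      = (\<lambda>v. \<Phi> (\<lambda>v. \<Sum>i<k. c i *\<^sub>C S i v) v + \<Phi> (\<lambda>v. c k *\<^sub>C S k v) v)"
    using \<Phi> Suc.prems BH_sum_scale[of "{..<k}" S c] BH_sum_scale[of "{k}" S c]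
    unfolding unital_positive_linear_map_def by simp
  moreover have "\<Phi> (\<lambda>v. c k *\<^sub>C S k v) = (\<lambda>v. c k *\<^sub>C \<Phi> (S k) v)"
    using \<Phi> Suc.prems unfolding unital_positive_linear_map_def by simp
  ultimately show ?case using Suc by simp
qed

lemma positive_op_rank_one: "positive_op (\<lambda>v. cinner v a *\<^sub>C a)"
proof -
  have "0 \<le> cinner v a * cinner a v" for v
    by (subst cinner_commute[of a v]) (auto simp: complex_norm_square[symmetric] less_eq_complex_def simp del: of_real_power)
  then show ?thesis
    by (simp add: positive_op_def BH_iff cinner_add_left cinner_scaleC_left scaleC_add_left scaleC_scaleC)
qed

section \<open>Dilation of the positive map and conclusion\<close>

theorem corollary3p7:
  fixes p :: real and J :: "real set" and h f :: "real \<Rightarrow> real"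
    and \<Phi> :: "('a::fin_dim_hilbert \<Rightarrow> 'a) \<Rightarrow> ('a \<Rightarrow> 'a)" and A :: "'a \<Rightarrow> 'a"
  assumes "p > 0"
    and "is_interval J" and "J \<subseteq> {0..}" and "{0<..<1} \<subseteq> J"
    and "\<forall>x\<in>J. 0 \<le> h x" and "\<exists>x\<in>J. h x \<noteq> 0"
    and "super_multiplicative_on J h"
    and "\<forall>\<alpha>\<in>{0<..<1}. 2 * h (1 / 2) \<le> inverse \<alpha> * h \<alpha>"
    and "unital_positive_linear_map \<Phi>"
    and "positive_op A"
    and "operator_ph_convex p h f" and "f 0 = 0"
  shows "le_op
    (fun_op f (fun_op (\<lambda>x. x powr (1 / p)) (\<Phi> (fun_op (\<lambda>x. x powr p) A))))
    (\<lambda>v. of_real (2 * h (1 / 2)) *\<^sub>C \<Phi> (fun_op f A) v)"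
proof -
  note \<Phi> = \<open>unital_positive_linear_map \<Phi>\<close>
  obtain n and b0 :: "nat \<Rightarrow> 'a" where b0: "orthonormal_basis n b0" by (rule exists_orthonormal_basis)
  obtain a d where a: "orthonormal_basis n a" and Aa: "\<And>i. i < n \<Longrightarrow> A (a i) = complex_of_real (d i) *\<^sub>C a i"
    and d: "\<And>i. i < n \<Longrightarrow> 0 \<le> d i"
    using positive_op_eigenbasis[OF b0 \<open>positive_op A\<close>] by metis
  have ABH: "A \<in> BH" using \<open>positive_op A\<close> by (simp add: positive_op_def)
  define R where "R i v = cinner v (a i) *\<^sub>C a i" for i v
  have R: "positive_op (R i)" "R i \<in> BH" for i
    using positive_op_rank_one[of "a i"] by (simp_all add: R_def[abs_def] positive_op_def)
  have fA: "fun_op g A = (\<lambda>v. \<Sum>i<n. complex_of_real (g (d i)) *\<^sub>C R i v)" for g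
    by (rule ext) (simp add: fun_op_eigenbasis[OF a ABH Aa] R_def scaleC_scaleC)
  have \<Phi>fA: "\<Phi> (fun_op g A) = (\<lambda>v. \<Sum>i<n. complex_of_real (g (d i)) *\<^sub>C \<Phi> (R i) v)" for g
    unfolding fA by (rule unital_positive_linear_map_sum[OF \<Phi>]) (rule R)
  have Q: "positive_op (\<Phi> (R i))" for i
    using \<Phi> R by (auto simp: unital_positive_linear_map_def)
  have Q1: "(\<Sum>i<n. \<Phi> (R i) v) = v" for v
  proof -
    \<comment> \<open>The functional calculus at the constant 1 is the identity, so unitality of
      \<open>\<Phi>\<close> makes the operators \<open>\<Phi> (R i)\<close> sum to the
      identity.\<close>
    have "fun_op (\<lambda>_. 1) A = (\<lambda>v. v)"
      by (rule ext) (simp add: fA R_def onb_expand[OF a])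
    then have "\<Phi> (fun_op (\<lambda>_. 1) A) = (\<lambda>v. v)"
      using \<Phi> by (simp add: unital_positive_linear_map_def)
    then show ?thesis by (simp add: \<Phi>fA fun_eq_iff)
  qed
  define T where "T = \<Phi> (fun_op (\<lambda>x. x powr p) A)"
  have T: "positive_op T"
    unfolding T_def \<Phi>fA by (rule positive_op_sum_scale) (auto intro: Q)
  obtain e t where e: "orthonormal_basis n e" and Te: "\<And>i. i < n \<Longrightarrow> T (e i) = complex_of_real (t i) *\<^sub>C e i"
    using positive_op_eigenbasis[OF b0 T] by metis
  \<comment> \<open>Each \<open>\<Phi> (R i)\<close> has its own eigenbasis \<open>b i\<close> with
    eigenvalues \<open>q i\<close>; these supply its rank-one pieces.\<close>
  have "\<forall>i. \<exists>b q. orthonormal_basis n b \<and> (\<forall>j<n. \<Phi> (R i) (b j) = complex_of_real (q j) *\<^sub>C b j \<and> 0 \<le> q j)"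
    using positive_op_eigenbasis[OF b0 Q] by metis
  then obtain b q where b: "\<And>i. orthonormal_basis n (b i)"
    and Qb: "\<And>i j. j < n \<Longrightarrow> \<Phi> (R i) (b i j) = complex_of_real (q i j) *\<^sub>C b i j"
    and q: "\<And>i j. j < n \<Longrightarrow> 0 \<le> q i j"
    by metis
  have QBH: "\<Phi> (R i) \<in> BH" for i using Q by (simp add: positive_op_def)
  have Qexp: "cinner (\<Phi> (R i) v) w = (\<Sum>j<n. of_real (q i j) * cinner v (b i j) * cnj (cinner w (b i j)))" for i v w
    by (subst onb_cinner[OF b[of i]]) (simp add: eigenbasis_cinner[OF b[of i] QBH Qb])
  \<comment> \<open>There are \<open>n * n\<close> rank-one pieces, indexed by pairs
    \<open>(r, s)\<close>; \<open>\<pi>\<close> numbers the pairs so that they can index the rows of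
    a matrix.\<close>
  define N where "N = card ({..<n} \<times> {..<n})"
  obtain \<pi> where \<pi>: "bij_betw \<pi> {..<N} ({..<n} \<times> {..<n})"
    using ex_bij_betw_nat_finite[of "{..<n} \<times> {..<n}"] by (auto simp: N_def atLeast0LessThan)
  have \<pi>_lt: "fst (\<pi> k) < n" "snd (\<pi> k) < n" if "k < N" for k
    using bij_betwE[OF \<pi>] that by (auto simp: mem_Times_iff)
  \<comment> \<open>All pieces of \<open>\<Phi> (R r)\<close> carry the eigenvalue
    \<open>d r\<close> of \<open>A\<close>. In \<open>V\<close>, the row of \<open>(r, s)\<close>
    represents the functional given by \<open>b r s\<close> in the basis \<open>e\<close>, weighted
    by the square root of \<open>q r s\<close>.\<close>
  define l where "l k = d (fst (\<pi> k))" for k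
  define V where "V = mat N n (\<lambda>(k, j). of_real (sqrt (case_prod q (\<pi> k))) * cinner (e j) (case_prod b (\<pi> k)))"
  have V: "V \<in> carrier_mat N n" by (simp add: V_def)
  \<comment> \<open>The dilation identity, for every \<open>g\<close> at once: \<open>g = 1\<close>
    shows that \<open>V\<close> is an isometry, the p-th power gives the matrix of \<open>T\<close>,
    and \<open>g = f\<close> gives the right side of the claim.\<close>
  have compr: "mat_adjoint V * mat_diag N (\<lambda>k. of_real (g (l k))) * V =
      mat n n (\<lambda>(i, j). cinner (\<Phi> (fun_op g A) (e j)) (e i))" for g
  proof (rule eq_matI)
    fix i j assume "i < dim_row (mat n n (\<lambda>(i, j). cinner (\<Phi> (fun_op g A) (e j)) (e i)))"
      "j < dim_col (mat n n (\<lambda>(i, j). cinner (\<Phi> (fun_op g A) (e j)) (e i)))"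
    then have ij: "i < n" "j < n" by simp_all
    have "(mat_adjoint V * mat_diag N (\<lambda>k. of_real (g (l k))) * V) $$ (i, j)
        = (\<Sum>k<N. cnj (V $$ (k, i)) * of_real (g (l k)) * V $$ (k, j))"
      using V ij by (simp add: mat_diag_mult_right[of _ n] scalar_prod_def atLeast0LessThan)
    also have "\<dots> = (\<Sum>k<N. case \<pi> k of (r, s) \<Rightarrow>
        of_real (g (d r)) * (of_real (q r s) * cinner (e j) (b r s) * cnj (cinner (e i) (b r s))))"
    proof (rule sum.cong[OF refl])
      fix k assume "k \<in> {..<N}"
      then have k: "k < N" by simp
      obtain r s where rs: "\<pi> k = (r, s)" by force
      have "complex_of_real (sqrt (q r s)) * of_real (sqrt (q r s)) = of_real (q r s)"
        using q[of s r] \<pi>_lt[OF k] rs by (simp flip: of_real_mult)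
      then show "cnj (V $$ (k, i)) * of_real (g (l k)) * V $$ (k, j) = (case \<pi> k of (r, s) \<Rightarrow>
          of_real (g (d r)) * (of_real (q r s) * cinner (e j) (b r s) * cnj (cinner (e i) (b r s))))"
        using k ij by (simp add: V_def rs l_def)
    qed
    also have "\<dots> = (\<Sum>(r, s)\<in>{..<n} \<times> {..<n}.
        of_real (g (d r)) * (of_real (q r s) * cinner (e j) (b r s) * cnj (cinner (e i) (b r s))))"
      by (rule sum.reindex_bij_betw[OF \<pi>])
    also have "\<dots> = cinner (\<Phi> (fun_op g A) (e j)) (e i)"
      by (simp add: \<Phi>fA cinner_sum_left cinner_scaleC_left Qexp sum_distrib_left sum.cartesian_product)
    finally show "(mat_adjoint V * mat_diag N (\<lambda>k. of_real (g (l k))) * V) $$ (i, j) =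
        mat n n (\<lambda>(i, j). cinner (\<Phi> (fun_op g A) (e j)) (e i)) $$ (i, j)"
      using ij by simp
  qed (use V in simp_all)
  have ee: "cinner (e i) (e j) = (if i = j then 1 else 0)" if "i < n" "j < n" for i j
    using onb_family[OF e] that by (simp add: orthonormal_family_def)
  have VV: "mat_adjoint V * V = 1\<^sub>m n"
  proof -
    have "mat_adjoint V * V = mat_adjoint V * mat_diag N (\<lambda>k. of_real 1) * V"
      using V by (simp add: right_mult_one_mat[of _ n N])
    also have "\<dots> = 1\<^sub>m n"
      unfolding compr[of "\<lambda>_. 1"] by (rule eq_matI) (auto simp: \<Phi>fA Q1 ee)
    finally show ?thesis .
  qed
  \<comment> \<open>The basis \<open>e\<close> consists of eigenvectors of \<open>T\<close>, so the
    compressed p-th power is diagonal.\<close>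
  have Vt: "mat_adjoint V * mat_diag N (\<lambda>i. of_real (l i powr p)) * V = mat_diag n (\<lambda>i. of_real (t i))"
    unfolding compr[of "\<lambda>x. x powr p"] T_def[symmetric]
    by (rule eq_matI) (auto simp: mat_diag_def Te ee cinner_scaleC_left)
  define G where "G = fun_op f (fun_op (\<lambda>x. x powr (1 / p)) T)"
  have TBH: "T \<in> BH" using T by (simp add: positive_op_def)
  have rank1: "(\<lambda>v. \<Sum>i<n. (complex_of_real (c i) * cinner v (e i)) *\<^sub>C e i) \<in> BH" for c
  proof -
    have "(\<lambda>v. cinner v (e i) *\<^sub>C e i) \<in> BH" for i
      using positive_op_rank_one[of "e i"] by (simp add: positive_op_def)
    then show ?thesis
      using BH_sum_scale[of "{..<n}" "\<lambda>i v. cinner v (e i) *\<^sub>C e i" "\<lambda>i. complex_of_real (c i)"]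
      by (simp add: scaleC_scaleC)
  qed
  have gT: "fun_op g T = (\<lambda>v. \<Sum>i<n. (complex_of_real (g (t i)) * cinner v (e i)) *\<^sub>C e i)" for g
    by (rule ext) (rule fun_op_eigenbasis[OF e TBH Te])
  \<comment> \<open>\<open>e\<close> is also an eigenbasis of every \<open>fun_op g T\<close>, so
    the nested functional calculus in \<open>G\<close> can be evaluated in the same basis.\<close>
  have gTe: "fun_op g T (e j) = complex_of_real (g (t j)) *\<^sub>C e j" if "j < n" for g j
    by (rule onb_eqI[OF e])
      (simp add: gT cinner_orthonormal_sum[OF onb_family[OF e]] cinner_scaleC_left that ee)
  have gTBH: "fun_op g T \<in> BH" for g unfolding gT by (rule rank1)
  have Gv: "G = (\<lambda>v. \<Sum>i<n. (complex_of_real (f (t i powr (1 / p))) * cinner v (e i)) *\<^sub>C e i)"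
    unfolding G_def by (rule ext) (rule fun_op_eigenbasis[OF e gTBH gTe])
  have GBH: "G \<in> BH" unfolding Gv by (rule rank1)
  have Ge: "cinner (G (e j)) (e i) = (if i = j then of_real (f (t i powr (1 / p))) else 0)" if "i < n" "j < n" for i j
    using that by (simp add: Gv cinner_orthonormal_sum[OF onb_family[OF e]] ee)
  let ?S = "\<lambda>v. of_real (2 * h (1 / 2)) *\<^sub>C \<Phi> (fun_op f A) v - G v"
  have "positive_op ?S"
  \<comment> \<open>The zero space is treated apart because operator convexity speaks only of
    matrices of size at least 1.\<close>
  proof (cases "n = 0")
    case True
    have "v = 0" for v :: 'a using onb_expand[OF e, of v] True by simp
    then show ?thesis unfolding positive_op_def BH_iff by (metis cinner_zero_left order_refl)
  next
    case False
    then have "1 \<le> N" by (simp add: N_def)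
    have "\<Phi> (fun_op f A) \<in> BH"
      unfolding \<Phi>fA by (rule BH_sum_scale) (rule QBH)
    then have SBH: "?S \<in> BH" by (rule BH_diff_scale[OF _ GBH])
    have "mat n n (\<lambda>(i, j). cinner (?S (e j)) (e i)) =
      of_real (2 * h (1 / 2)) \<cdot>\<^sub>m (mat_adjoint V * mat_diag N (\<lambda>i. of_real (f (l i))) * V) -
        mat_diag n (\<lambda>i. of_real (f (t i powr (1 / p))))"
      unfolding compr
      by (rule eq_matI) (auto simp: mat_diag_def cinner_diff_left cinner_scaleC_left Ge)
    also have "\<dots> \<in> psd_mat n"
    proof (rule ph_convex_compression[OF \<open>operator_ph_convex p h f\<close> \<open>1 \<le> N\<close> V VV _ Vt])
      show "0 \<le> l i" if "i < N" for i using d \<pi>_lt that by (simp add: l_def)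
    qed
    finally show ?thesis by (rule positive_op_matrixI[OF e SBH])
  qed
  then show ?thesis by (simp add: le_op_def G_def T_def)
qed

end
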